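(* Let $\{\mathbf{X}_n\}_{n\ge1}$ be a stationary sequence satisfying the strong-mixing condition and $\{\mathbf{u}_n^{(\pmb{\tau})}=(u_{n1}^{(\tau_1)},\ldots,u_{nd}^{(\tau_d)})\}$ a sequence of normalized real levels for which $\Gamma(\pmb{\tau})$ exists. Then $$\theta(\pmb{\tau})\Gamma(\pmb{\tau})=\theta^{**}\,\tau^{**}\Big(\bigwedge_{j=1}^d\tau_j\Big)+\theta^{*}(\pmb{\tau})\,\Gamma^{*}(\pmb{\tau})\,\beta^{(1)}(\pmb{\tau})+\sum_{\emptyset\neq J\subset D}(-1)^{|J|+1}\Theta_J(\pmb{\tau}_J),$$ where $$\beta^{(1)}(\pmb{\tau})=\lim_{n\to\infty}P\left(N^{**}_{r_n}=0\,\middle|\,N^{*}_{r_n}>0\right)$$ and $$\Theta_J(\pmb{\tau}_J)=\lim_{n\to\infty}k_nP\Big(\bigcap_{j\in J}\{N_{r_n,\{j\}}>0\}\,\Big|\,N^{*}_{r_n}=0\Big).$$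
   Context: Setting. $\{\mathbf{X}_n=(X_{n1},\ldots,X_{nd})\}_{n\ge1}$ is a stationary sequence of random vectors, $D=\{1,\ldots,d\}$, whose common distribution function $F$ has continuous marginals $F_j$ and satisfies $F^n(nx_1,\ldots,nx_d)\to\widehat H(x_1,\ldots,x_d)$, where $\widehat H$ is a multivariate extreme value distribution function with unit Fréchet marginals $\widehat H_j(x)=\exp(-x^{-1})$, $x>0$. $\wedge,\vee$ denote minimum and maximum. Levels. For $\pmb{\tau}=(\tau_1,\ldots,\tau_d)\in\mathbb{R}^d_+$ (all $\tau_j>0$), normalized levels $u_{nj}=u_{nj}^{(\tau_j)}$ are such that $nP(X_{1j}>u_{nj}^{(\tau_j)})\to\tau_j$ for each $j$; for instance $u_{nj}^{(\tau_j)}=n/\tau_j$. $\Gamma(\pmb{\tau})=\lim_{n\to\infty}nP\big(\bigcup_{j=1}^d\{X_{1j}>u_{nj}\}\big)$. $\pmb{\tau}_J=(\tau_j)_{j\in J}$. Counting processes. For $\emptyset\neq J\subset D$ and $m\le n$ (levels $u_{nj}$ fixed at index $n$), $N_{m,J}=\sum_{i=1}^m\mathbf{1}_{\{\bigcup_{j\in J}\{X_{ij}>u_{nj}\}\}}$, $N^*_{m,J}=\sum_{i=1}^m\mathbf{1}_{\{\bigcap_{j\in J}\{X_{ij}>u_{nj}\}\}}$, $N^{**}_{m,J}=\sum_{i=1}^m\mathbf{1}_{\{\bigwedge_{j\in J}X_{ij}>\bigvee_{j\in J}u_{nj}\}}$. When $J=D$ the index $J$ is omitted. Limiting mean numbers.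 $\Gamma^*_J(\pmb{\tau}_J)=\lim_n nP(\bigcap_{j\in J}\{X_{1j}>u_{nj}\})$ and $\tau^{**}_J(\bigwedge_{j\in J}\tau_j)=\lim_n nP(\bigcap_{j\in J}\{X_{1j}>\bigvee_{j\in J}u_{nj}\})=\lim_n nP(\bigcap_{j\in J}\{X_{1j}>n/\bigwedge_{j\in J}\tau_j\})$. Strong-mixing condition. With $\alpha_n(l)=\sup|P(B\cap C)-P(B)P(C)|$, the supremum being over $1\le p\le n-l$, $B\in\sigma(\mathbf{X}_1,\ldots,\mathbf{X}_p)$ and $C\in\sigma(\mathbf{X}_{p+l},\ldots,\mathbf{X}_n)$, there is $l_n=o(n)$ with $\alpha_n(l_n)\to0$. $\{k_n\}$ are integers with $k_n\to\infty$, $k_n\alpha_n(l_n)\to0$, $k_nl_n/n\to0$, and $r_n=[n/k_n]$. Extremal indexes. They are defined by $\theta_J(\pmb{\tau}_J)\Gamma_J(\pmb{\tau}_J)=\lim_n k_nP(N_{r_n,J}>0)$ (with $\Gamma_J(\pmb{\tau}_J)=\lim_n nP(\bigcup_{j\in J}\{X_{1j}>u_{nj}\})$), $\theta^*_J(\pmb{\tau}_J)\Gamma^*_J(\pmb{\tau}_J)=\lim_n k_nP(N^*_{r_n,J}>0)$, $\theta^{**}_J\tau^{**}_J(\bigwedge_{j\in J}\tau_j)=\lim_n k_nP(N^{**}_{r_n,J}>0)$; $\theta^{**}_J$ does not depend on $\pmb{\tau}$. The index $J$ is omitted when $J=D$. All the limits defining the quantities in the statement are assumed to exist. *)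

theory Defs
  imports "HOL-Probability.Probability" "HOL-Library.Landau_Symbols"
begin

text \<open>
  Random vectors take values in \<^typ>\<open>real^'d\<close>, the finite type \<^typ>\<open>'d\<close> being the index set
  \<open>D\<close>; sets of coordinates are \<open>J :: 'd set\<close> and \<open>D\<close> itself is \<open>UNIV\<close>. Sequences of random vectors
  are indexed by \<open>nat\<close>, but only the indices \<open>i \<ge> 1\<close> are ever used.
\<close>

section \<open>Stationarity and strong mixing\<close>

definition stationary_sequence :: "'a measure \<Rightarrow> (nat \<Rightarrow> 'a \<Rightarrow> 'b::topological_space) \<Rightarrow> bool" where
  "stationary_sequence M X \<longleftrightarrow>
     (\<forall>h I. finite I \<and> I \<subseteq> {1..} \<longrightarrow>
        distr M (Pi\<^sub>M I (\<lambda>_. borel)) (\<lambda>\<omega>. \<lambda>i\<in>I. X (i + h) \<omega>) =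
        distr M (Pi\<^sub>M I (\<lambda>_. borel)) (\<lambda>\<omega>. \<lambda>i\<in>I. X i \<omega>))"

definition gen_events :: "'a measure \<Rightarrow> (nat \<Rightarrow> 'a \<Rightarrow> 'b::topological_space) \<Rightarrow> nat set \<Rightarrow> 'a set set" where
  "gen_events M X I =
     sigma_sets (space M) (\<Union>i\<in>I. {X i -` A \<inter> space M | A. A \<in> sets borel})"

text \<open>
  For \<open>l \<ge> n\<close> the supremum ranges over the empty set and is an unspecified real number; only
  \<open>l = o(n)\<close> is used.
\<close>

definition mixing_coeff :: "'a measure \<Rightarrow> (nat \<Rightarrow> 'a \<Rightarrow> 'b::topological_space) \<Rightarrow> nat \<Rightarrow> nat \<Rightarrow> real" where
  "mixing_coeff M X n l =
     Sup {\<bar>measure M (B \<inter> C) - measure M B * measure M C\<bar> | p B C.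
            1 \<le> p \<and> p \<le> n - l \<and> B \<in> gen_events M X {1..p} \<and> C \<in> gen_events M X {p + l..n}}"

definition strong_mixing :: "'a measure \<Rightarrow> (nat \<Rightarrow> 'a \<Rightarrow> 'b::topological_space) \<Rightarrow> (nat \<Rightarrow> nat) \<Rightarrow> bool" where
  "strong_mixing M X l \<longleftrightarrow>
     (\<lambda>n. real (l n)) \<in> o(\<lambda>n. real n) \<and> (\<lambda>n. mixing_coeff M X n (l n)) \<longlonglongrightarrow> 0"

definition block_numbers ::
    "'a measure \<Rightarrow> (nat \<Rightarrow> 'a \<Rightarrow> 'b::topological_space) \<Rightarrow> (nat \<Rightarrow> nat) \<Rightarrow> (nat \<Rightarrow> nat) \<Rightarrow> bool" where
  "block_numbers M X l k \<longleftrightarrow>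
     filterlim k at_top sequentially \<and>
     (\<lambda>n. real (k n) * mixing_coeff M X n (l n)) \<longlonglongrightarrow> 0 \<and>
     (\<lambda>n. real (k n) * real (l n) / real n) \<longlonglongrightarrow> 0"

section \<open>Multivariate extreme value distributions\<close>

definition joint_cdf :: "(real^'d) measure \<Rightarrow> real^'d \<Rightarrow> real" where
  "joint_cdf \<nu> x = measure \<nu> {y. \<forall>j. y $ j \<le> x $ j}"

definition marginal :: "(real^'d) measure \<Rightarrow> 'd \<Rightarrow> real measure" where
  "marginal \<nu> j = distr \<nu> borel (\<lambda>y. y $ j)"

text \<open>
  A multivariate extreme value distribution is a law with nondegenerate marginals that is the weak
  limit of affinely normalized componentwise maxima of independent vectors with a common law
  \<open>\<mu>\<close>; the \<open>n\<close>-th power is the distribution function of such a maximum.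
\<close>

definition mev_distribution :: "(real^'d) measure \<Rightarrow> bool" where
  "mev_distribution \<nu> \<longleftrightarrow>
     prob_space \<nu> \<and> sets \<nu> = sets borel \<and>
     (\<forall>j c. marginal \<nu> j \<noteq> return borel c) \<and>
     (\<exists>\<mu> a b. prob_space \<mu> \<and> sets \<mu> = sets borel \<and>
        (\<forall>n\<ge>1. \<forall>j. (a :: nat \<Rightarrow> real^'d) n $ j > 0) \<and>
        (\<forall>x. isCont (joint_cdf \<nu>) x \<longrightarrow>
           (\<lambda>n. joint_cdf \<mu> (\<chi> j. a n $ j * x $ j + (b n :: real^'d) $ j) ^ n)
             \<longlonglongrightarrow> joint_cdf \<nu> x))"

section \<open>Counting processes\<close>

text \<open>
  In the following definitions \<open>v\<close> is the vector of levels at one fixed index. The sets \<open>J\<close> are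
  meant to be nonempty.
\<close>

definition exc_any :: "(nat \<Rightarrow> 'a \<Rightarrow> real^'d) \<Rightarrow> real^'d \<Rightarrow> 'd set \<Rightarrow> nat \<Rightarrow> 'a \<Rightarrow> nat" where
  "exc_any X v J m \<omega> = (\<Sum>i=1..m. of_bool (\<exists>j\<in>J. X i \<omega> $ j > v $ j))"

definition exc_all :: "(nat \<Rightarrow> 'a \<Rightarrow> real^'d) \<Rightarrow> real^'d \<Rightarrow> 'd set \<Rightarrow> nat \<Rightarrow> 'a \<Rightarrow> nat" where
  "exc_all X v J m \<omega> = (\<Sum>i=1..m. of_bool (\<forall>j\<in>J. X i \<omega> $ j > v $ j))"

definition exc_min :: "(nat \<Rightarrow> 'a \<Rightarrow> real^'d) \<Rightarrow> real^'d \<Rightarrow> 'd set \<Rightarrow> nat \<Rightarrow> 'a \<Rightarrow> nat" where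
  "exc_min X v J m \<omega> = (\<Sum>i=1..m. of_bool ((MIN j\<in>J. X i \<omega> $ j) > (MAX j\<in>J. v $ j)))"

section \<open>Limiting mean numbers\<close>

text \<open>
  Each limit is defined together with the sequence it is taken of. The limits are meaningful only
  under the assumption that these sequences are \<^const>\<open>convergent\<close>.
\<close>

definition normalized_levels ::
    "'a measure \<Rightarrow> (nat \<Rightarrow> 'a \<Rightarrow> real^'d) \<Rightarrow> real^'d \<Rightarrow> (nat \<Rightarrow> real^'d) \<Rightarrow> bool" where
  "normalized_levels M X \<tau> u \<longleftrightarrow>
     (\<forall>j. (\<lambda>n. real n * \<P>(\<omega> in M. X 1 \<omega> $ j > u n $ j)) \<longlonglongrightarrow> \<tau> $ j)"

definition mean_any ::
    "'a measure \<Rightarrow> (nat \<Rightarrow> 'a \<Rightarrow> real^'d) \<Rightarrow> (nat \<Rightarrow> real^'d) \<Rightarrow> 'd set \<Rightarrow> nat \<Rightarrow> real" where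
  "mean_any M X u J n = real n * \<P>(\<omega> in M. \<exists>j\<in>J. X 1 \<omega> $ j > u n $ j)"

definition Gamma_any ::
    "'a measure \<Rightarrow> (nat \<Rightarrow> 'a \<Rightarrow> real^'d) \<Rightarrow> (nat \<Rightarrow> real^'d) \<Rightarrow> 'd set \<Rightarrow> real" where
  "Gamma_any M X u J = lim (mean_any M X u J)"

definition mean_all ::
    "'a measure \<Rightarrow> (nat \<Rightarrow> 'a \<Rightarrow> real^'d) \<Rightarrow> (nat \<Rightarrow> real^'d) \<Rightarrow> 'd set \<Rightarrow> nat \<Rightarrow> real" where
  "mean_all M X u J n = real n * \<P>(\<omega> in M. \<forall>j\<in>J. X 1 \<omega> $ j > u n $ j)"

definition Gamma_all ::
    "'a measure \<Rightarrow> (nat \<Rightarrow> 'a \<Rightarrow> real^'d) \<Rightarrow> (nat \<Rightarrow> real^'d) \<Rightarrow> 'd set \<Rightarrow> real" where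
  "Gamma_all M X u J = lim (mean_all M X u J)"

text \<open>
  \<open>tau_min\<close> is \<open>\<tau>\<^sup>*\<^sup>*\<close>, a function of the single number \<open>t\<close>, which will be the minimum of the
  \<open>\<tau> $ j\<close>.
\<close>

definition mean_min ::
    "'a measure \<Rightarrow> (nat \<Rightarrow> 'a \<Rightarrow> real^'d) \<Rightarrow> 'd set \<Rightarrow> real \<Rightarrow> nat \<Rightarrow> real" where
  "mean_min M X J t n = real n * \<P>(\<omega> in M. \<forall>j\<in>J. X 1 \<omega> $ j > real n / t)"

definition tau_min ::
    "'a measure \<Rightarrow> (nat \<Rightarrow> 'a \<Rightarrow> real^'d) \<Rightarrow> 'd set \<Rightarrow> real \<Rightarrow> real" where
  "tau_min M X J t = lim (mean_min M X J t)"

section \<open>Extremal indexes and the remaining terms\<close>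

text \<open>
  \<open>k n\<close> is the number of blocks and \<open>n div k n\<close> the block length \<open>r\<^sub>n\<close>. The extremal indexes are
  defined implicitly, by their products with the limiting mean numbers.
\<close>

definition extremal_index_any ::
    "'a measure \<Rightarrow> (nat \<Rightarrow> 'a \<Rightarrow> real^'d) \<Rightarrow> (nat \<Rightarrow> real^'d) \<Rightarrow> (nat \<Rightarrow> nat) \<Rightarrow> 'd set \<Rightarrow> real \<Rightarrow> bool" where
  "extremal_index_any M X u k J \<theta> \<longleftrightarrow>
     (\<lambda>n. real (k n) * \<P>(\<omega> in M. exc_any X (u n) J (n div k n) \<omega> > 0))
       \<longlonglongrightarrow> \<theta> * Gamma_any M X u J"

definition extremal_index_all ::
    "'a measure \<Rightarrow> (nat \<Rightarrow> 'a \<Rightarrow> real^'d) \<Rightarrow> (nat \<Rightarrow> real^'d) \<Rightarrow> (nat \<Rightarrow> nat) \<Rightarrow> 'd set \<Rightarrow> real \<Rightarrow> bool" where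
  "extremal_index_all M X u k J \<theta> \<longleftrightarrow>
     (\<lambda>n. real (k n) * \<P>(\<omega> in M. exc_all X (u n) J (n div k n) \<omega> > 0))
       \<longlonglongrightarrow> \<theta> * Gamma_all M X u J"

definition extremal_index_min ::
    "'a measure \<Rightarrow> (nat \<Rightarrow> 'a \<Rightarrow> real^'d) \<Rightarrow> real^'d \<Rightarrow> (nat \<Rightarrow> real^'d) \<Rightarrow> (nat \<Rightarrow> nat) \<Rightarrow> 'd set \<Rightarrow> real \<Rightarrow> bool" where
  "extremal_index_min M X \<tau> u k J \<theta> \<longleftrightarrow>
     (\<lambda>n. real (k n) * \<P>(\<omega> in M. exc_min X (u n) J (n div k n) \<omega> > 0))
       \<longlonglongrightarrow> \<theta> * tau_min M X J (MIN j\<in>J. \<tau> $ j)"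

text \<open>
  By the convention \<open>x / 0 = 0\<close>, a conditional probability given a null event is \<open>0\<close>.
\<close>

definition beta1_seq ::
    "'a measure \<Rightarrow> (nat \<Rightarrow> 'a \<Rightarrow> real^'d) \<Rightarrow> (nat \<Rightarrow> real^'d) \<Rightarrow> (nat \<Rightarrow> nat) \<Rightarrow> nat \<Rightarrow> real" where
  "beta1_seq M X u k n =
     \<P>(\<omega> in M. exc_min X (u n) UNIV (n div k n) \<omega> = 0 \<bar> exc_all X (u n) UNIV (n div k n) \<omega> > 0)"

definition beta1 ::
    "'a measure \<Rightarrow> (nat \<Rightarrow> 'a \<Rightarrow> real^'d) \<Rightarrow> (nat \<Rightarrow> real^'d) \<Rightarrow> (nat \<Rightarrow> nat) \<Rightarrow> real" where
  "beta1 M X u k = lim (beta1_seq M X u k)"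

definition Theta_seq ::
    "'a measure \<Rightarrow> (nat \<Rightarrow> 'a \<Rightarrow> real^'d) \<Rightarrow> (nat \<Rightarrow> real^'d) \<Rightarrow> (nat \<Rightarrow> nat) \<Rightarrow> 'd set \<Rightarrow> nat \<Rightarrow> real" where
  "Theta_seq M X u k J n =
     real (k n) * \<P>(\<omega> in M. \<forall>j\<in>J. exc_any X (u n) {j} (n div k n) \<omega> > 0
                          \<bar> exc_all X (u n) UNIV (n div k n) \<omega> = 0)"

definition Theta ::
    "'a measure \<Rightarrow> (nat \<Rightarrow> 'a \<Rightarrow> real^'d) \<Rightarrow> (nat \<Rightarrow> real^'d) \<Rightarrow> (nat \<Rightarrow> nat) \<Rightarrow> 'd set \<Rightarrow> real" where
  "Theta M X u k J = lim (Theta_seq M X u k J)"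

end

theory Submission
  imports Defs
begin

text \<open>
  An exceedance of some coordinate in a block either comes with a simultaneous exceedance of all
  coordinates, or it does not. In the first case, split according to whether the minimum of some
  vector exceeds the largest level; in the second case, condition on the absence of simultaneous
  exceedances and apply inclusion-exclusion over the coordinates. This gives an identity for every
  block. Multiply it by \<open>k\<^sub>n\<close> and pass to the limit: as \<open>k\<^sub>n P(N\<^sup>*\<^bsub>r\<^sub>n\<^esub> > 0)\<close> converges and
  \<open>k\<^sub>n \<rightarrow> \<infinity>\<close>, the probability of the conditioning event tends to \<open>1\<close>.
\<close>

lemma exc_any_pos_iff:
  "exc_any X v J m \<omega> > 0 \<longleftrightarrow> (\<exists>i\<in>{1..m}. \<exists>j\<in>J. X i \<omega> $ j > v $ j)"
  by (auto simp: exc_any_def sum_nonneg_eq_0_iff simp flip: neq0_conv)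

lemma exc_all_pos_iff:
  "exc_all X v J m \<omega> > 0 \<longleftrightarrow> (\<exists>i\<in>{1..m}. \<forall>j\<in>J. X i \<omega> $ j > v $ j)"
  by (auto simp: exc_all_def sum_nonneg_eq_0_iff simp flip: neq0_conv)

text \<open>Since \<open>J\<close> is finite and nonempty, \<open>MIN\<close> and \<open>MAX\<close>
  are attained, so comparing them amounts to comparing all pairs. In this form measurability is
  immediate, and taking \<open>j' = j\<close> gives an exceedance in every coordinate of
  \<open>J\<close>.\<close>

lemma exc_min_pos_iff:
  fixes v :: "real^'d"
  assumes "J \<noteq> {}"
  shows "exc_min X v J m \<omega> > 0 \<longleftrightarrow> (\<exists>i\<in>{1..m}. \<forall>j\<in>J. \<forall>j'\<in>J. X i \<omega> $ j > v $ j')"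
proof -
  have "(MIN j\<in>J. X i \<omega> $ j) > (MAX j\<in>J. v $ j) \<longleftrightarrow> (\<forall>j\<in>J. \<forall>j'\<in>J. X i \<omega> $ j > v $ j')" for i
    using assms by (subst Min_gr_iff; simp add: Max_less_iff)
  then show ?thesis
    by (auto simp: exc_min_def sum_nonneg_eq_0_iff simp flip: neq0_conv)
qed

context
  fixes M :: "'a measure" and X :: "nat \<Rightarrow> 'a \<Rightarrow> real^'d" and m :: nat
  assumes X [measurable]: "\<And>i. i \<ge> 1 \<Longrightarrow> X i \<in> borel_measurable M"
begin

lemma sets_coord_gt: "i \<ge> 1 \<Longrightarrow> {\<omega> \<in> space M. X i \<omega> $ j > c} \<in> sets M"
  by measurable

lemma sets_exc_any: "{\<omega> \<in> space M. exc_any X v J m \<omega> > 0} \<in> sets M"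
  unfolding exc_any_pos_iff by (intro sets.sets_Collect_finite_Ex sets_coord_gt) auto

lemma sets_exc_all: "{\<omega> \<in> space M. exc_all X v J m \<omega> > 0} \<in> sets M"
  unfolding exc_all_pos_iff
  by (intro sets.sets_Collect_finite_Ex sets.sets_Collect_finite_All sets_coord_gt) auto

lemma sets_exc_min: "J \<noteq> {} \<Longrightarrow> {\<omega> \<in> space M. exc_min X v J m \<omega> > 0} \<in> sets M"
  by (subst exc_min_pos_iff, assumption)
    (intro sets.sets_Collect_finite_Ex sets.sets_Collect_finite_All sets_coord_gt; simp)

end

text \<open>The product rule survives a null condition: the conditional probability is then
  \<open>0\<close> by convention, and monotonicity forces the left-hand side to be \<open>0\<close>
  as well. Hence the block identity below is exact for every block.\<close>

lemma (in prob_space) prob_conj_eq_mult_cond_prob: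
  assumes "{\<omega> \<in> space M. Q \<omega>} \<in> sets M"
  shows "\<P>(\<omega> in M. P \<omega> \<and> Q \<omega>) = \<P>(\<omega> in M. Q \<omega>) * \<P>(\<omega> in M. P \<omega> \<bar> Q \<omega>)"
proof (cases "\<P>(\<omega> in M. Q \<omega>) = 0")
  case True
  moreover have "\<P>(\<omega> in M. P \<omega> \<and> Q \<omega>) \<le> \<P>(\<omega> in M. Q \<omega>)"
    using assms by (intro finite_measure_mono) auto
  ultimately show ?thesis
    by (simp add: measure_le_0_iff)
next
  case False
  then show ?thesis
    by (simp add: cond_prob_def)
qed

text \<open>This is inclusion-exclusion for the finite measure obtained by restricting
  \<open>prob\<close> to the event \<open>Q\<close>. Intersecting with \<open>Q\<close> instead of
  conditioning on it avoids any division here.\<close>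

lemma (in prob_space) prob_inclusion_exclusion:
  assumes "finite A" "\<And>j. j \<in> A \<Longrightarrow> {\<omega> \<in> space M. P j \<omega>} \<in> sets M"
    and E: "{\<omega> \<in> space M. Q \<omega>} \<in> sets M"
  shows "\<P>(\<omega> in M. (\<exists>j\<in>A. P j \<omega>) \<and> Q \<omega>) =
           (\<Sum>J\<in>Pow A - {{}}. (-1) ^ (card J + 1) * \<P>(\<omega> in M. (\<forall>j\<in>J. P j \<omega>) \<and> Q \<omega>))"
proof -
  let ?E = "{\<omega> \<in> space M. Q \<omega>}" and ?G = "\<lambda>j. {\<omega> \<in> space M. P j \<omega>}"
  \<comment> \<open>The general principle asks only for a set function that is additive on disjoint
    measurable sets.\<close>
  interpret Incl_Excl "\<lambda>S. S \<in> sets M" "\<lambda>S. prob (S \<inter> ?E)"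
  proof
    fix S T assume "S \<in> sets M" "T \<in> sets M" "disjnt S T"
    then show "prob ((S \<union> T) \<inter> ?E) = prob (S \<inter> ?E) + prob (T \<inter> ?E)"
      using E by (subst finite_measure_Union [symmetric])
        (auto simp: disjnt_def intro!: arg_cong [where f = prob])
  qed auto
  have "\<P>(\<omega> in M. (\<exists>j\<in>A. P j \<omega>) \<and> Q \<omega>) = prob (\<Union> (?G ` A) \<inter> ?E)"
    by (rule arg_cong [where f = prob]) auto
  also have "\<dots> = (\<Sum>J | J \<subseteq> A \<and> J \<noteq> {}. (-1) ^ (card J + 1) * prob (\<Inter> (?G ` J) \<inter> ?E))"
    using assms by (intro restricted_indexed)
  also have "\<dots> = (\<Sum>J\<in>Pow A - {{}}. (-1) ^ (card J + 1) * \<P>(\<omega> in M. (\<forall>j\<in>J. P j \<omega>) \<and> Q \<omega>))"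
    by (intro sum.cong arg_cong2 [where f = "(*)"] arg_cong [where f = prob]) auto
  finally show ?thesis .
qed

lemma (in prob_space) prob_exc_any_decomposition:
  fixes X :: "nat \<Rightarrow> 'a \<Rightarrow> real^'d"
  assumes X: "\<And>i. i \<ge> 1 \<Longrightarrow> X i \<in> borel_measurable M"
  shows "\<P>(\<omega> in M. exc_any X v UNIV m \<omega> > 0) =
           \<P>(\<omega> in M. exc_min X v UNIV m \<omega> > 0)
           + \<P>(\<omega> in M. exc_all X v UNIV m \<omega> > 0)
             * \<P>(\<omega> in M. exc_min X v UNIV m \<omega> = 0 \<bar> exc_all X v UNIV m \<omega> > 0)
           + \<P>(\<omega> in M. exc_all X v UNIV m \<omega> = 0)
             * (\<Sum>J\<in>Pow UNIV - {{}}. (-1) ^ (card J + 1) *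
                 \<P>(\<omega> in M. \<forall>j\<in>J. exc_any X v {j} m \<omega> > 0 \<bar> exc_all X v UNIV m \<omega> = 0))"
proof -
  let ?any = "\<lambda>\<omega>. exc_any X v UNIV m \<omega> > 0" and ?all = "\<lambda>\<omega>. exc_all X v UNIV m \<omega> > 0"
    and ?min = "\<lambda>\<omega>. exc_min X v UNIV m \<omega> > 0" and ?any1 = "\<lambda>j \<omega>. exc_any X v {j} m \<omega> > 0"
  note [measurable] = sets_exc_any [OF X] sets_exc_all [OF X] sets_exc_min [OF X UNIV_not_empty]
  have any_iff: "?any \<omega> \<longleftrightarrow> (\<exists>j\<in>UNIV. ?any1 j \<omega>)" for \<omega>
    by (auto simp: exc_any_pos_iff)
  \<comment> \<open>The three events are nested, so the successive differences below are disjoint.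
    The second implication uses that \<open>UNIV\<close> is nonempty.\<close>
  have imp: "?min \<omega> \<Longrightarrow> ?all \<omega>" "?all \<omega> \<Longrightarrow> ?any \<omega>" for \<omega>
    by (auto simp: exc_any_pos_iff exc_all_pos_iff exc_min_pos_iff)
  have "\<P>(\<omega> in M. ?any \<omega>) = \<P>(\<omega> in M. ?min \<omega>) + \<P>(\<omega> in M. \<not> ?min \<omega> \<and> ?all \<omega>)
          + \<P>(\<omega> in M. ?any \<omega> \<and> \<not> ?all \<omega>)"
  proof -
    have "\<P>(\<omega> in M. ?min \<omega>) + \<P>(\<omega> in M. \<not> ?min \<omega> \<and> ?all \<omega>) = \<P>(\<omega> in M. ?all \<omega>)"
      by (subst finite_measure_Union [symmetric], measurable)
        (auto dest: imp intro!: arg_cong [where f = prob])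
    moreover have "\<P>(\<omega> in M. ?all \<omega>) + \<P>(\<omega> in M. ?any \<omega> \<and> \<not> ?all \<omega>) = \<P>(\<omega> in M. ?any \<omega>)"
      by (subst finite_measure_Union [symmetric], measurable)
        (auto dest: imp intro!: arg_cong [where f = prob])
    ultimately show ?thesis
      by simp
  qed
  also have "\<P>(\<omega> in M. \<not> ?min \<omega> \<and> ?all \<omega>) = \<P>(\<omega> in M. ?all \<omega>) * \<P>(\<omega> in M. \<not> ?min \<omega> \<bar> ?all \<omega>)"
    by (intro prob_conj_eq_mult_cond_prob) measurable
  also have "\<P>(\<omega> in M. ?any \<omega> \<and> \<not> ?all \<omega>) =
      (\<Sum>J\<in>Pow UNIV - {{}}. (-1) ^ (card J + 1) * \<P>(\<omega> in M. (\<forall>j\<in>J. ?any1 j \<omega>) \<and> \<not> ?all \<omega>))"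
    unfolding any_iff by (intro prob_inclusion_exclusion) measurable
  also have "\<dots> = (\<Sum>J\<in>Pow UNIV - {{}}. (-1) ^ (card J + 1) *
      (\<P>(\<omega> in M. \<not> ?all \<omega>) * \<P>(\<omega> in M. \<forall>j\<in>J. ?any1 j \<omega> \<bar> \<not> ?all \<omega>)))"
    by (intro sum.cong refl arg_cong2 [where f = "(*)"] prob_conj_eq_mult_cond_prob) measurable
  finally show ?thesis
    by (simp add: sum_distrib_left mult.left_commute)
qed

theorem proposition2p2:
  fixes M :: "'a measure"
    and X :: "nat \<Rightarrow> 'a \<Rightarrow> real^'d"
    and H :: "(real^'d) measure"
    and \<tau> :: "real^'d"
    and u :: "nat \<Rightarrow> real^'d"
    and l k :: "nat \<Rightarrow> nat"
    and \<theta> \<theta>_all \<theta>_min :: real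
  assumes "prob_space M"
    and "\<And>i. i \<ge> 1 \<Longrightarrow> X i \<in> borel_measurable M"
    and "stationary_sequence M X"
    and "\<And>j. continuous_on UNIV (cdf (marginal (distr M borel (X 1)) j))"
    and "mev_distribution H"
    and "\<And>j x. x > 0 \<Longrightarrow> cdf (marginal H j) x = exp (- (1 / x))"
    and "\<And>x. (\<lambda>n. joint_cdf (distr M borel (X 1)) (real n *\<^sub>R x) ^ n) \<longlonglongrightarrow> joint_cdf H x"
    and "strong_mixing M X l"
    and "block_numbers M X l k"
    and "\<And>j. \<tau> $ j > 0"
    and "normalized_levels M X \<tau> u"
    and "convergent (mean_any M X u UNIV)"
    and "convergent (mean_all M X u UNIV)"
    and "convergent (mean_min M X UNIV (MIN j. \<tau> $ j))"
    and "extremal_index_any M X u k UNIV \<theta>"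
    and "extremal_index_all M X u k UNIV \<theta>_all"
    and "extremal_index_min M X \<tau> u k UNIV \<theta>_min"
    and "convergent (beta1_seq M X u k)"
    and "\<And>J. J \<noteq> {} \<Longrightarrow> convergent (Theta_seq M X u k J)"
  shows "\<theta> * Gamma_any M X u UNIV =
           \<theta>_min * tau_min M X UNIV (MIN j. \<tau> $ j)
           + \<theta>_all * Gamma_all M X u UNIV * beta1 M X u k
           + (\<Sum>J\<in>Pow UNIV - {{}}. (-1) ^ (card J + 1) * Theta M X u k J)"
proof -
  interpret prob_space M by fact
  have X: "\<And>i. i \<ge> 1 \<Longrightarrow> X i \<in> borel_measurable M" by fact
  define r where "r n = n div k n" for n
  define p_any where "p_any n = \<P>(\<omega> in M. exc_any X (u n) UNIV (r n) \<omega> > 0)" for n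
  define p_all where "p_all n = \<P>(\<omega> in M. exc_all X (u n) UNIV (r n) \<omega> > 0)" for n
  define p_min where "p_min n = \<P>(\<omega> in M. exc_min X (u n) UNIV (r n) \<omega> > 0)" for n
  have any: "(\<lambda>n. k n * p_any n) \<longlonglongrightarrow> \<theta> * Gamma_any M X u UNIV"
    and all: "(\<lambda>n. k n * p_all n) \<longlonglongrightarrow> \<theta>_all * Gamma_all M X u UNIV"
    and min: "(\<lambda>n. k n * p_min n) \<longlonglongrightarrow> \<theta>_min * tau_min M X UNIV (MIN j. \<tau> $ j)"
    using assms unfolding extremal_index_any_def extremal_index_all_def extremal_index_min_def
      p_any_def p_all_def p_min_def r_def by blast+
  \<comment> \<open>The operator \<open>lim\<close> denotes the actual limit only for a convergent
    sequence; this is where the convergence assumptions enter.\<close>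
  have beta: "beta1_seq M X u k \<longlonglongrightarrow> beta1 M X u k"
    unfolding beta1_def using assms convergent_LIMSEQ_iff by blast
  have Theta: "Theta_seq M X u k J \<longlonglongrightarrow> Theta M X u k J" if "J \<noteq> {}" for J
    unfolding Theta_def using assms that convergent_LIMSEQ_iff by blast
  have k: "filterlim (\<lambda>n. real (k n)) at_top sequentially"
    using \<open>block_numbers M X l k\<close> unfolding block_numbers_def
    by (intro filterlim_compose [OF filterlim_real_sequentially]) auto
  have "(\<lambda>n. k n * p_all n / k n) \<longlonglongrightarrow> 0"
    using all filterlim_at_top_imp_at_infinity [OF k] by (rule tendsto_divide_0)
  \<comment> \<open>Cancelling is valid only eventually: where \<open>k n = 0\<close> the quotient
    is \<open>0\<close> by convention.\<close>
  moreover have "\<forall>\<^sub>F n in sequentially. k n * p_all n / k n = p_all n"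
    using filterlim_at_top_dense [THEN iffD1, OF k, rule_format, of 0]
    by eventually_elim auto
  ultimately have p_all: "p_all \<longlonglongrightarrow> 0"
    by (rule Lim_transform_eventually)
  \<comment> \<open>\<open>Theta_seq\<close> already carries the factor \<open>k n\<close>, so only
    \<open>1 - p_all n\<close> stands in front of the sum.\<close>
  have "k n * p_any n = k n * p_min n + k n * p_all n * beta1_seq M X u k n
      + (1 - p_all n) * (\<Sum>J\<in>Pow UNIV - {{}}. (-1) ^ (card J + 1) * Theta_seq M X u k J n)" for n
  proof -
    let ?S = "\<Sum>J\<in>Pow UNIV - {{}}. (-1) ^ (card J + 1) *
      \<P>(\<omega> in M. \<forall>j\<in>J. exc_any X (u n) {j} (r n) \<omega> > 0 \<bar> exc_all X (u n) UNIV (r n) \<omega> = 0)"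
    have "\<P>(\<omega> in M. exc_all X (u n) UNIV (r n) \<omega> = 0) = 1 - p_all n"
      using prob_neg [OF sets_exc_all [where X = X and v = "u n" and J = UNIV and m = "r n", OF X]]
      by (simp add: p_all_def)
    then have "p_any n = p_min n + p_all n * beta1_seq M X u k n + (1 - p_all n) * ?S"
      using prob_exc_any_decomposition [where X = X and v = "u n" and m = "r n", OF X]
      by (simp only: p_any_def p_all_def p_min_def beta1_seq_def r_def)
    moreover have "(\<Sum>J\<in>Pow UNIV - {{}}. (-1) ^ (card J + 1) * Theta_seq M X u k J n) = k n * ?S"
      unfolding Theta_seq_def r_def sum_distrib_left by (simp only: mult.left_commute)
    ultimately show ?thesis
      by (simp only: distrib_left mult_ac)
  qed
  \<comment> \<open>The sum is finite, so its limit is taken term by term; \<open>1 - 0\<close> is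
    the limit of the conditioning probability \<open>1 - p_all n\<close>.\<close>
  then have "(\<lambda>n. k n * p_any n) \<longlonglongrightarrow>
      \<theta>_min * tau_min M X UNIV (MIN j. \<tau> $ j) + \<theta>_all * Gamma_all M X u UNIV * beta1 M X u k
      + (1 - 0) * (\<Sum>J\<in>Pow UNIV - {{}}. (-1) ^ (card J + 1) * Theta M X u k J)"
    by (simp only:) (intro tendsto_intros min all beta p_all Theta; simp)
  with any show ?thesis
    using LIMSEQ_unique by fastforce
qed

end
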